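(* Let $\Theta$ be a first-order signature. For every set $\Gamma\cup\{\varphi\}\subseteq For(\Theta)$: if $\Gamma\vdash_{\mathbf{QLFI1}_\circ}\varphi$, then $\Gamma\models_{\mathbf{QLFI1}_\circ}\varphi$ (semantical consequence with respect to first-order twist structures).
   Context: **Language.** $Var$ is a denumerable set of individual variables. A first-order signature $\Theta$ consists of a set of individual constants and, for each $n\ge 1$, sets of function and predicate symbols of arity $n$ (with at least one predicate symbol). Formulas are built with binary connectives $\wedge,\vee,\to$, unary connectives $\neg,\circ$, and quantifiers $\forall,\exists$. $For(\Theta)$, $Sen(\Theta)$ are the sets of formulas and sentences. $\varphi[x/t]$ is the result of replacing every free occurrence of $x$ in $\varphi$ by $t$. $\alpha\leftrightarrow\beta$ abbreviates $(\alpha\to\beta)\wedge(\beta\to\alpha)$. **Calculus $\mathbf{QLFI1}_\circ$** (Hilbert calculus over $For(\Theta)$). Axiom schemas: (A1) $\alpha\to(\beta\to\alpha)$; (A2) $(\alpha\to(\beta\to\gamma))\to((\alpha\to\beta)\to(\alpha\to\gamma))$; (A3) $\alpha\to(\beta\to(\alpha\wedge\beta))$; (A4) $(\alpha\wedge\beta)\to\alpha$; (A5) $(\alpha\wedge\beta)\to\beta$; (A6) $\alpha\to(\alpha\vee\beta)$; (A7) $\beta\to(\alpha\vee\beta)$; (A8) $(\alpha\to\gamma)\to((\beta\to\gamma)\to((\alpha\vee\beta)\to\gamma))$; (A9) $\alpha\vee(\alpha\to\beta)$; (A10) $\alpha\vee\neg\alpha$; (A11) $\circ\alpha\to(\alpha\to(\neg\alpha\to\beta))$;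 (ci) $\neg\circ\alpha\to(\alpha\wedge\neg\alpha)$; (dneg) $\neg\neg\alpha\leftrightarrow\alpha$; (neg$\vee$) $\neg(\alpha\vee\beta)\leftrightarrow(\neg\alpha\wedge\neg\beta)$; (neg$\wedge$) $\neg(\alpha\wedge\beta)\leftrightarrow(\neg\alpha\vee\neg\beta)$; (neg$\to$) $\neg(\alpha\to\beta)\leftrightarrow(\alpha\wedge\neg\beta)$; (Ax12) $\varphi[x/t]\to\exists x\varphi$ if $t$ is free for $x$ in $\varphi$; (Ax13) $\forall x\varphi\to\varphi[x/t]$ if $t$ is free for $x$ in $\varphi$; (Ax$\neg\exists$) $\neg\exists x\varphi\leftrightarrow\forall x\neg\varphi$; (Ax$\neg\forall$) $\neg\forall x\varphi\leftrightarrow\exists x\neg\varphi$. Rules: (MP) from $\alpha$, $\alpha\to\beta$ infer $\beta$; ($\exists$-In) from $\varphi\to\psi$ infer $\exists x\varphi\to\psi$ if $x$ is not free in $\psi$; ($\forall$-In) from $\varphi\to\psi$ infer $\varphi\to\forall x\psi$ if $x$ is not free in $\varphi$. $\Gamma\vdash_{\mathbf{QLFI1}_\circ}\varphi$ means there is a finite derivation of $\varphi$ whose steps are axiom instances, members of $\Gamma$, or follow from earlier steps by a rule. **Twist structures.** For a Boolean algebra $\mathcal A$ with domain $A$, let $T_{\mathcal A}=\{(z_1,z_2)\in A\times A: z_1\vee z_2=1\}$. The twist structure $\mathcal T_{\mathcal A}$ is the algebra on $T_{\mathcal A}$ with operations $(z_1,z_2)\tilde\wedge(w_1,w_2)=(z_1\wedge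 w_1,z_2\vee w_2)$; $(z_1,z_2)\tilde\vee(w_1,w_2)=(z_1\vee w_1,z_2\wedge w_2)$; $(z_1,z_2)\tilde\to(w_1,w_2)=(z_1\to w_1,z_1\wedge w_2)$; $\tilde\neg(z_1,z_2)=(z_2,z_1)$; $\tilde\circ(z_1,z_2)=({\sim}(z_1\wedge z_2),z_1\wedge z_2)$, where ${\sim}$ is Boolean complement. The associated matrix is $\mathcal{MT}_{\mathcal A}=\langle\mathcal T_{\mathcal A},D_{\mathcal A}\rangle$ with $D_{\mathcal A}=\{(z_1,z_2)\in T_{\mathcal A}: z_1=1\}$. **Structures and interpretation.** Let $\mathcal A$ be a complete Boolean algebra. A structure $\mathfrak A=\langle U,I_{\mathfrak A}\rangle$ over $\mathcal{MT}_{\mathcal A}$ and $\Theta$ has a nonempty domain $U$ and assigns $c^{\mathfrak A}\in U$ to constants, $f^{\mathfrak A}:U^n\to U$ to $n$-ary function symbols, $P^{\mathfrak A}:U^n\to T_{\mathcal A}$ to $n$-ary predicate symbols. $\Theta_U$ is $\Theta$ plus a new constant $\bar a$ for each $a\in U$; $\widehat{\mathfrak A}$ extends $\mathfrak A$ by interpreting $\bar a$ as $a$; $[\![t]\!]^{\widehat{\mathfrak A}}$ is the usual value of a closed term $t$. The interpretation map $[\![\cdot]\!]^{\mathfrak A}:Sen(\Theta_U)\to T_{\mathcal A}$ is defined by: $[\![P(t_1,\dots,t_n)]\!]^{\mathfrak A}=P^{\mathfrak A}([\![t_1]\!]^{\widehat{\mathfrak A}},\dots,[\![t_n]\!]^{\widehat{\mathfrak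 A}})$; $[\![\#\varphi]\!]^{\mathfrak A}=\tilde\#[\![\varphi]\!]^{\mathfrak A}$ for $\#\in\{\neg,\circ\}$; $[\![\varphi\#\psi]\!]^{\mathfrak A}=[\![\varphi]\!]^{\mathfrak A}\tilde\#[\![\psi]\!]^{\mathfrak A}$ for $\#\in\{\wedge,\vee,\to\}$; $[\![\forall x\varphi]\!]^{\mathfrak A}=\big(\bigwedge_{a\in U}([\![\varphi[x/\bar a]]\!]^{\mathfrak A})_1,\bigvee_{a\in U}([\![\varphi[x/\bar a]]\!]^{\mathfrak A})_2\big)$; $[\![\exists x\varphi]\!]^{\mathfrak A}=\big(\bigvee_{a\in U}([\![\varphi[x/\bar a]]\!]^{\mathfrak A})_1,\bigwedge_{a\in U}([\![\varphi[x/\bar a]]\!]^{\mathfrak A})_2\big)$. For an assignment $\mu:Var\to U$, $[\![\varphi]\!]^{\mathfrak A}_\mu=[\![\widehat\mu(\varphi)]\!]^{\mathfrak A}$, where $\widehat\mu(\varphi)$ replaces each free variable $x$ of $\varphi$ by $\overline{\mu(x)}$. **Consequence.** $\Gamma\models_{(\mathfrak A,\mathcal{MT}_{\mathcal A})}\varphi$ iff: if $[\![\gamma]\!]^{\mathfrak A}_\mu\in D_{\mathcal A}$ for all $\gamma\in\Gamma$ and all $\mu$, then $[\![\varphi]\!]^{\mathfrak A}_\mu\in D_{\mathcal A}$ for all $\mu$. $\Gamma\models_{\mathbf{QLFI1}_\circ}\varphi$ iff $\Gamma\models_{(\mathfrak A,\mathcal{MT}_{\mathcal A})}\varphi$ for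 every complete Boolean algebra $\mathcal A$ and every structure $\mathfrak A$ over $\mathcal{MT}_{\mathcal A}$ and $\Theta$. *)

theory Defs
  imports Main
begin

section \<open>First-order language\<close>

text \<open>The denumerable set of individual variables is \<^typ>\<open>nat\<close>.\<close>

datatype ('c, 'f) tm =
    Var nat
  | Const 'c
  | Fun 'f "('c, 'f) tm list"

datatype ('c, 'f, 'p) fm =
    Pred 'p "('c, 'f) tm list"
  | And "('c, 'f, 'p) fm" "('c, 'f, 'p) fm"  (infixr \<open>\<^bold>\<and>\<close> 65)
  | Or "('c, 'f, 'p) fm" "('c, 'f, 'p) fm"  (infixr \<open>\<^bold>\<or>\<close> 60)
  | Imp "('c, 'f, 'p) fm" "('c, 'f, 'p) fm"  (infixr \<open>\<^bold>\<longrightarrow>\<close> 55)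
  | Neg "('c, 'f, 'p) fm"  (\<open>\<^bold>\<not> _\<close> [70] 70)
  | Circ "('c, 'f, 'p) fm"  (\<open>\<^bold>\<circ> _\<close> [70] 70)
  | Forall nat "('c, 'f, 'p) fm"
  | Exists nat "('c, 'f, 'p) fm"

abbreviation Iff :: "('c, 'f, 'p) fm \<Rightarrow> ('c, 'f, 'p) fm \<Rightarrow> ('c, 'f, 'p) fm"
    (infix \<open>\<^bold>\<longleftrightarrow>\<close> 50)
  where "\<alpha> \<^bold>\<longleftrightarrow> \<beta> \<equiv> (\<alpha> \<^bold>\<longrightarrow> \<beta>) \<^bold>\<and> (\<beta> \<^bold>\<longrightarrow> \<alpha>)"

text \<open>Symbols of arity \<open>n\<close> are only considered for \<open>n \<ge> 1\<close>; the values of \<open>fun_syms\<close> and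
  \<open>pred_syms\<close> at \<open>0\<close> are never used.\<close>

record ('c, 'f, 'p) sig =
  const_syms :: "'c set"
  fun_syms :: "nat \<Rightarrow> 'f set"
  pred_syms :: "nat \<Rightarrow> 'p set"

definition signature :: "('c, 'f, 'p) sig \<Rightarrow> bool"
  where "signature \<Theta> \<longleftrightarrow> (\<exists>n\<ge>1. pred_syms \<Theta> n \<noteq> {})"

primrec wf_tm :: "('c, 'f, 'p) sig \<Rightarrow> ('c, 'f) tm \<Rightarrow> bool"
  where
    "wf_tm \<Theta> (Var x) \<longleftrightarrow> True"
  | "wf_tm \<Theta> (Const c) \<longleftrightarrow> c \<in> const_syms \<Theta>"
  | "wf_tm \<Theta> (Fun f ts) \<longleftrightarrow>
       length ts \<ge> 1 \<and> f \<in> fun_syms \<Theta> (length ts) \<and> list_all (wf_tm \<Theta>) ts"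

primrec wf_fm :: "('c, 'f, 'p) sig \<Rightarrow> ('c, 'f, 'p) fm \<Rightarrow> bool"
  where
    "wf_fm \<Theta> (Pred p ts) \<longleftrightarrow>
       length ts \<ge> 1 \<and> p \<in> pred_syms \<Theta> (length ts) \<and> list_all (wf_tm \<Theta>) ts"
  | "wf_fm \<Theta> (\<alpha> \<^bold>\<and> \<beta>) \<longleftrightarrow> wf_fm \<Theta> \<alpha> \<and> wf_fm \<Theta> \<beta>"
  | "wf_fm \<Theta> (\<alpha> \<^bold>\<or> \<beta>) \<longleftrightarrow> wf_fm \<Theta> \<alpha> \<and> wf_fm \<Theta> \<beta>"
  | "wf_fm \<Theta> (\<alpha> \<^bold>\<longrightarrow> \<beta>) \<longleftrightarrow> wf_fm \<Theta> \<alpha> \<and> wf_fm \<Theta> \<beta>"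
  | "wf_fm \<Theta> (\<^bold>\<not> \<alpha>) \<longleftrightarrow> wf_fm \<Theta> \<alpha>"
  | "wf_fm \<Theta> (\<^bold>\<circ> \<alpha>) \<longleftrightarrow> wf_fm \<Theta> \<alpha>"
  | "wf_fm \<Theta> (Forall x \<alpha>) \<longleftrightarrow> wf_fm \<Theta> \<alpha>"
  | "wf_fm \<Theta> (Exists x \<alpha>) \<longleftrightarrow> wf_fm \<Theta> \<alpha>"

definition For :: "('c, 'f, 'p) sig \<Rightarrow> ('c, 'f, 'p) fm set"
  where "For \<Theta> = {\<phi>. wf_fm \<Theta> \<phi>}"

primrec vars_tm :: "('c, 'f) tm \<Rightarrow> nat set"
  where
    "vars_tm (Var x) = {x}"
  | "vars_tm (Const c) = {}"
  | "vars_tm (Fun f ts) = \<Union> (set (map vars_tm ts))"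

primrec free_vars :: "('c, 'f, 'p) fm \<Rightarrow> nat set"
  where
    "free_vars (Pred p ts) = \<Union> (set (map vars_tm ts))"
  | "free_vars (\<alpha> \<^bold>\<and> \<beta>) = free_vars \<alpha> \<union> free_vars \<beta>"
  | "free_vars (\<alpha> \<^bold>\<or> \<beta>) = free_vars \<alpha> \<union> free_vars \<beta>"
  | "free_vars (\<alpha> \<^bold>\<longrightarrow> \<beta>) = free_vars \<alpha> \<union> free_vars \<beta>"
  | "free_vars (\<^bold>\<not> \<alpha>) = free_vars \<alpha>"
  | "free_vars (\<^bold>\<circ> \<alpha>) = free_vars \<alpha>"
  | "free_vars (Forall x \<alpha>) = free_vars \<alpha> - {x}"
  | "free_vars (Exists x \<alpha>) = free_vars \<alpha> - {x}"

text \<open>Simultaneous replacement of every free occurrence of each variable \<open>x\<close> by \<open>\<sigma> x\<close>. There is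
  no renaming of bound variables, so capture is possible; it is excluded where necessary by
  \<open>free_for\<close> below.\<close>

primrec subst_tm :: "(nat \<Rightarrow> ('c, 'f) tm) \<Rightarrow> ('c, 'f) tm \<Rightarrow> ('c, 'f) tm"
  where
    "subst_tm \<sigma> (Var x) = \<sigma> x"
  | "subst_tm \<sigma> (Const c) = Const c"
  | "subst_tm \<sigma> (Fun f ts) = Fun f (map (subst_tm \<sigma>) ts)"

primrec subst_fm :: "(nat \<Rightarrow> ('c, 'f) tm) \<Rightarrow> ('c, 'f, 'p) fm \<Rightarrow> ('c, 'f, 'p) fm"
  where
    "subst_fm \<sigma> (Pred p ts) = Pred p (map (subst_tm \<sigma>) ts)"
  | "subst_fm \<sigma> (\<alpha> \<^bold>\<and> \<beta>) = subst_fm \<sigma> \<alpha> \<^bold>\<and> subst_fm \<sigma> \<beta>"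
  | "subst_fm \<sigma> (\<alpha> \<^bold>\<or> \<beta>) = subst_fm \<sigma> \<alpha> \<^bold>\<or> subst_fm \<sigma> \<beta>"
  | "subst_fm \<sigma> (\<alpha> \<^bold>\<longrightarrow> \<beta>) = subst_fm \<sigma> \<alpha> \<^bold>\<longrightarrow> subst_fm \<sigma> \<beta>"
  | "subst_fm \<sigma> (\<^bold>\<not> \<alpha>) = \<^bold>\<not> (subst_fm \<sigma> \<alpha>)"
  | "subst_fm \<sigma> (\<^bold>\<circ> \<alpha>) = \<^bold>\<circ> (subst_fm \<sigma> \<alpha>)"
  | "subst_fm \<sigma> (Forall x \<alpha>) = Forall x (subst_fm (\<sigma>(x := Var x)) \<alpha>)"
  | "subst_fm \<sigma> (Exists x \<alpha>) = Exists x (subst_fm (\<sigma>(x := Var x)) \<alpha>)"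

definition subst :: "('c, 'f, 'p) fm \<Rightarrow> nat \<Rightarrow> ('c, 'f) tm \<Rightarrow> ('c, 'f, 'p) fm"
    (\<open>_[_'/'/_]\<close> [1000, 0, 0] 1000)
  where "\<phi>[x//t] = subst_fm (Var(x := t)) \<phi>"

text \<open>\<open>t\<close> is free for \<open>x\<close> in \<open>\<phi>\<close>: no free occurrence of \<open>x\<close> in \<open>\<phi>\<close> lies in the scope of a
  quantifier that binds a variable of \<open>t\<close>.\<close>

primrec free_for :: "('c, 'f) tm \<Rightarrow> nat \<Rightarrow> ('c, 'f, 'p) fm \<Rightarrow> bool"
  where
    "free_for t x (Pred p ts) \<longleftrightarrow> True"
  | "free_for t x (\<alpha> \<^bold>\<and> \<beta>) \<longleftrightarrow> free_for t x \<alpha> \<and> free_for t x \<beta>"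
  | "free_for t x (\<alpha> \<^bold>\<or> \<beta>) \<longleftrightarrow> free_for t x \<alpha> \<and> free_for t x \<beta>"
  | "free_for t x (\<alpha> \<^bold>\<longrightarrow> \<beta>) \<longleftrightarrow> free_for t x \<alpha> \<and> free_for t x \<beta>"
  | "free_for t x (\<^bold>\<not> \<alpha>) \<longleftrightarrow> free_for t x \<alpha>"
  | "free_for t x (\<^bold>\<circ> \<alpha>) \<longleftrightarrow> free_for t x \<alpha>"
  | "free_for t x (Forall y \<alpha>) \<longleftrightarrow>
       x \<notin> free_vars (Forall y \<alpha>) \<or> y \<notin> vars_tm t \<and> free_for t x \<alpha>"
  | "free_for t x (Exists y \<alpha>) \<longleftrightarrow>
       x \<notin> free_vars (Exists y \<alpha>) \<or> y \<notin> vars_tm t \<and> free_for t x \<alpha>"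


section \<open>The Hilbert calculus\<close>

text \<open>Membership of the instances in \<open>For \<Theta>\<close> is imposed on the steps of a derivation below. This
  amounts to taking the instances over \<open>\<Theta>\<close>: in \<open>Ax12\<close> and \<open>Ax13\<close> the term \<open>t\<close> occurs in the
  instance unless \<open>x\<close> is not free in \<open>\<phi>\<close>, and then the instance does not depend on \<open>t\<close>.\<close>

inductive ax :: "('c, 'f, 'p) fm \<Rightarrow> bool"
  where
    A1: "ax (\<alpha> \<^bold>\<longrightarrow> (\<beta> \<^bold>\<longrightarrow> \<alpha>))"
  | A2: "ax ((\<alpha> \<^bold>\<longrightarrow> (\<beta> \<^bold>\<longrightarrow> \<gamma>)) \<^bold>\<longrightarrow> ((\<alpha> \<^bold>\<longrightarrow> \<beta>) \<^bold>\<longrightarrow> (\<alpha> \<^bold>\<longrightarrow> \<gamma>)))"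
  | A3: "ax (\<alpha> \<^bold>\<longrightarrow> (\<beta> \<^bold>\<longrightarrow> (\<alpha> \<^bold>\<and> \<beta>)))"
  | A4: "ax ((\<alpha> \<^bold>\<and> \<beta>) \<^bold>\<longrightarrow> \<alpha>)"
  | A5: "ax ((\<alpha> \<^bold>\<and> \<beta>) \<^bold>\<longrightarrow> \<beta>)"
  | A6: "ax (\<alpha> \<^bold>\<longrightarrow> (\<alpha> \<^bold>\<or> \<beta>))"
  | A7: "ax (\<beta> \<^bold>\<longrightarrow> (\<alpha> \<^bold>\<or> \<beta>))"
  | A8: "ax ((\<alpha> \<^bold>\<longrightarrow> \<gamma>) \<^bold>\<longrightarrow> ((\<beta> \<^bold>\<longrightarrow> \<gamma>) \<^bold>\<longrightarrow> ((\<alpha> \<^bold>\<or> \<beta>) \<^bold>\<longrightarrow> \<gamma>)))"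
  | A9: "ax (\<alpha> \<^bold>\<or> (\<alpha> \<^bold>\<longrightarrow> \<beta>))"
  | A10: "ax (\<alpha> \<^bold>\<or> \<^bold>\<not> \<alpha>)"
  | A11: "ax (\<^bold>\<circ> \<alpha> \<^bold>\<longrightarrow> (\<alpha> \<^bold>\<longrightarrow> (\<^bold>\<not> \<alpha> \<^bold>\<longrightarrow> \<beta>)))"
  | ci: "ax (\<^bold>\<not> (\<^bold>\<circ> \<alpha>) \<^bold>\<longrightarrow> (\<alpha> \<^bold>\<and> \<^bold>\<not> \<alpha>))"
  | dneg: "ax (\<^bold>\<not> (\<^bold>\<not> \<alpha>) \<^bold>\<longleftrightarrow> \<alpha>)"
  | neg_or: "ax (\<^bold>\<not> (\<alpha> \<^bold>\<or> \<beta>) \<^bold>\<longleftrightarrow> (\<^bold>\<not> \<alpha> \<^bold>\<and> \<^bold>\<not> \<beta>))"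
  | neg_and: "ax (\<^bold>\<not> (\<alpha> \<^bold>\<and> \<beta>) \<^bold>\<longleftrightarrow> (\<^bold>\<not> \<alpha> \<^bold>\<or> \<^bold>\<not> \<beta>))"
  | neg_imp: "ax (\<^bold>\<not> (\<alpha> \<^bold>\<longrightarrow> \<beta>) \<^bold>\<longleftrightarrow> (\<alpha> \<^bold>\<and> \<^bold>\<not> \<beta>))"
  | Ax12: "free_for t x \<phi> \<Longrightarrow> ax (\<phi>[x//t] \<^bold>\<longrightarrow> Exists x \<phi>)"
  | Ax13: "free_for t x \<phi> \<Longrightarrow> ax (Forall x \<phi> \<^bold>\<longrightarrow> \<phi>[x//t])"
  | neg_Exists: "ax (\<^bold>\<not> (Exists x \<phi>) \<^bold>\<longleftrightarrow> Forall x (\<^bold>\<not> \<phi>))"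
  | neg_Forall: "ax (\<^bold>\<not> (Forall x \<phi>) \<^bold>\<longleftrightarrow> Exists x (\<^bold>\<not> \<phi>))"

text \<open>\<open>rule_from X \<chi>\<close>: \<open>\<chi>\<close> follows by one rule application from premises in \<open>X\<close>.\<close>

inductive rule_from :: "('c, 'f, 'p) fm set \<Rightarrow> ('c, 'f, 'p) fm \<Rightarrow> bool"
  for X :: "('c, 'f, 'p) fm set"
  where
    MP: "\<alpha> \<in> X \<Longrightarrow> (\<alpha> \<^bold>\<longrightarrow> \<beta>) \<in> X \<Longrightarrow> rule_from X \<beta>"
  | Exists_In: "(\<phi> \<^bold>\<longrightarrow> \<psi>) \<in> X \<Longrightarrow> x \<notin> free_vars \<psi> \<Longrightarrow> rule_from X (Exists x \<phi> \<^bold>\<longrightarrow> \<psi>)"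
  | Forall_In: "(\<phi> \<^bold>\<longrightarrow> \<psi>) \<in> X \<Longrightarrow> x \<notin> free_vars \<phi> \<Longrightarrow> rule_from X (\<phi> \<^bold>\<longrightarrow> Forall x \<psi>)"

definition derivation ::
    "('c, 'f, 'p) sig \<Rightarrow> ('c, 'f, 'p) fm set \<Rightarrow> ('c, 'f, 'p) fm list \<Rightarrow> bool"
  where "derivation \<Theta> \<Gamma> \<phi>s \<longleftrightarrow>
    (\<forall>i<length \<phi>s. \<phi>s ! i \<in> For \<Theta> \<and>
      (ax (\<phi>s ! i) \<or> \<phi>s ! i \<in> \<Gamma> \<or> rule_from (set (take i \<phi>s)) (\<phi>s ! i)))"

definition derivable ::
    "('c, 'f, 'p) sig \<Rightarrow> ('c, 'f, 'p) fm set \<Rightarrow> ('c, 'f, 'p) fm \<Rightarrow> bool"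
  where "derivable \<Theta> \<Gamma> \<phi> \<longleftrightarrow> (\<exists>\<phi>s. derivation \<Theta> \<Gamma> \<phi>s \<and> \<phi>s \<noteq> [] \<and> last \<phi>s = \<phi>)"


section \<open>Twist structures\<close>

text \<open>A complete Boolean algebra is a type of sort \<open>{boolean_algebra, complete_lattice}\<close>. The
  library class \<^class>\<open>complete_boolean_algebra\<close> would be too narrow: it requires complete
  distributivity.\<close>

definition twist_carrier :: "('a::boolean_algebra \<times> 'a) set"
  where "twist_carrier = {(z1, z2). sup z1 z2 = top}"

definition designated :: "('a::boolean_algebra \<times> 'a) set"
  where "designated = {(z1, z2) \<in> twist_carrier. z1 = top}"

fun twist_and :: "'a::boolean_algebra \<times> 'a \<Rightarrow> 'a \<times> 'a \<Rightarrow> 'a \<times> 'a"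
  where "twist_and (z1, z2) (w1, w2) = (inf z1 w1, sup z2 w2)"

fun twist_or :: "'a::boolean_algebra \<times> 'a \<Rightarrow> 'a \<times> 'a \<Rightarrow> 'a \<times> 'a"
  where "twist_or (z1, z2) (w1, w2) = (sup z1 w1, inf z2 w2)"

fun twist_imp :: "'a::boolean_algebra \<times> 'a \<Rightarrow> 'a \<times> 'a \<Rightarrow> 'a \<times> 'a"
  where "twist_imp (z1, z2) (w1, w2) = (sup (- z1) w1, inf z1 w2)"

fun twist_neg :: "'a::boolean_algebra \<times> 'a \<Rightarrow> 'a \<times> 'a"
  where "twist_neg (z1, z2) = (z2, z1)"

fun twist_circ :: "'a::boolean_algebra \<times> 'a \<Rightarrow> 'a \<times> 'a"
  where "twist_circ (z1, z2) = (- inf z1 z2, inf z1 z2)"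


section \<open>Structures and interpretation\<close>

text \<open>Elements of \<open>U\<^sup>n\<close> are lists of length \<open>n\<close> over \<open>U\<close>.\<close>

record ('c, 'f, 'p, 'u, 'a) struct =
  dom :: "'u set"
  cint :: "'c \<Rightarrow> 'u"
  fint :: "'f \<Rightarrow> 'u list \<Rightarrow> 'u"
  pint :: "'p \<Rightarrow> 'u list \<Rightarrow> 'a \<times> 'a"

definition structure_over ::
    "('c, 'f, 'p) sig \<Rightarrow> ('c, 'f, 'p, 'u, 'a::{boolean_algebra, complete_lattice}) struct \<Rightarrow> bool"
  where "structure_over \<Theta> \<AA> \<longleftrightarrow>
    dom \<AA> \<noteq> {} \<and>
    (\<forall>c \<in> const_syms \<Theta>. cint \<AA> c \<in> dom \<AA>) \<and>
    (\<forall>n\<ge>1. \<forall>f \<in> fun_syms \<Theta> n. \<forall>us. length us = n \<and> set us \<subseteq> dom \<AA> \<longrightarrow> fint \<AA> f us \<in> dom \<AA>) \<and>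
    (\<forall>n\<ge>1. \<forall>p \<in> pred_syms \<Theta> n. \<forall>us. length us = n \<and> set us \<subseteq> dom \<AA> \<longrightarrow> pint \<AA> p us \<in> twist_carrier)"

text \<open>The constants of \<open>\<Theta>\<^sub>U\<close> are \<open>Inl c\<close> for a constant \<open>c\<close> of \<open>\<Theta>\<close> and \<open>Inr a\<close> for the new
  constant naming \<open>a \<in> U\<close>.\<close>

definition hat ::
    "('c, 'f, 'p, 'u, 'a) struct \<Rightarrow> ('c + 'u, 'f, 'p, 'u, 'a) struct"
  where "hat \<AA> = \<lparr>dom = dom \<AA>, cint = case_sum (cint \<AA>) (\<lambda>a. a), fint = fint \<AA>, pint = pint \<AA>\<rparr>"

text \<open>Only closed terms have a meaningful value.\<close>

primrec tval :: "('c, 'f, 'p, 'u, 'a) struct \<Rightarrow> ('c, 'f) tm \<Rightarrow> 'u"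
  where
    "tval \<AA> (Var x) = undefined"
  | "tval \<AA> (Const c) = cint \<AA> c"
  | "tval \<AA> (Fun f ts) = fint \<AA> f (map (tval \<AA>) ts)"

primrec complexity :: "('c, 'f, 'p) fm \<Rightarrow> nat"
  where
    "complexity (Pred p ts) = 0"
  | "complexity (\<alpha> \<^bold>\<and> \<beta>) = Suc (complexity \<alpha> + complexity \<beta>)"
  | "complexity (\<alpha> \<^bold>\<or> \<beta>) = Suc (complexity \<alpha> + complexity \<beta>)"
  | "complexity (\<alpha> \<^bold>\<longrightarrow> \<beta>) = Suc (complexity \<alpha> + complexity \<beta>)"
  | "complexity (\<^bold>\<not> \<alpha>) = Suc (complexity \<alpha>)"
  | "complexity (\<^bold>\<circ> \<alpha>) = Suc (complexity \<alpha>)"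
  | "complexity (Forall x \<alpha>) = Suc (complexity \<alpha>)"
  | "complexity (Exists x \<alpha>) = Suc (complexity \<alpha>)"

lemma complexity_subst_fm [simp]: "complexity (subst_fm \<sigma> \<phi>) = complexity \<phi>"
  by (induction \<phi> arbitrary: \<sigma>) auto

lemma complexity_subst [simp]: "complexity (\<phi>[x//t]) = complexity \<phi>"
  by (simp add: subst_def)

text \<open>The interpretation map, intended for sentences over \<open>\<Theta>\<^sub>U\<close>; on other formulas its value is
  irrelevant.\<close>

function interp ::
    "('c, 'f, 'p, 'u, 'a::{boolean_algebra, complete_lattice}) struct \<Rightarrow> ('c + 'u, 'f, 'p) fm \<Rightarrow> 'a \<times> 'a"
  where
    "interp \<AA> (Pred p ts) = pint \<AA> p (map (tval (hat \<AA>)) ts)"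
  | "interp \<AA> (\<alpha> \<^bold>\<and> \<beta>) = twist_and (interp \<AA> \<alpha>) (interp \<AA> \<beta>)"
  | "interp \<AA> (\<alpha> \<^bold>\<or> \<beta>) = twist_or (interp \<AA> \<alpha>) (interp \<AA> \<beta>)"
  | "interp \<AA> (\<alpha> \<^bold>\<longrightarrow> \<beta>) = twist_imp (interp \<AA> \<alpha>) (interp \<AA> \<beta>)"
  | "interp \<AA> (\<^bold>\<not> \<alpha>) = twist_neg (interp \<AA> \<alpha>)"
  | "interp \<AA> (\<^bold>\<circ> \<alpha>) = twist_circ (interp \<AA> \<alpha>)"
  | "interp \<AA> (Forall x \<alpha>) =
      (INF a \<in> dom \<AA>. fst (interp \<AA> (\<alpha>[x//Const (Inr a)])),
       SUP a \<in> dom \<AA>. snd (interp \<AA> (\<alpha>[x//Const (Inr a)])))"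
  | "interp \<AA> (Exists x \<alpha>) =
      (SUP a \<in> dom \<AA>. fst (interp \<AA> (\<alpha>[x//Const (Inr a)])),
       INF a \<in> dom \<AA>. snd (interp \<AA> (\<alpha>[x//Const (Inr a)])))"
  by pat_completeness auto
termination
  by (relation "measure (\<lambda>(\<AA>, \<phi>). complexity \<phi>)") auto

text \<open>\<open>close_fm \<mu> \<phi>\<close> regards \<open>\<phi>\<close> as a formula over \<open>\<Theta>\<^sub>U\<close> and replaces each free variable \<open>x\<close> by the
  constant naming \<open>\<mu> x\<close>.\<close>

definition close_fm :: "(nat \<Rightarrow> 'u) \<Rightarrow> ('c, 'f, 'p) fm \<Rightarrow> ('c + 'u, 'f, 'p) fm"
  where "close_fm \<mu> \<phi> = subst_fm (\<lambda>x. Const (Inr (\<mu> x))) (map_fm Inl (\<lambda>f. f) (\<lambda>p. p) \<phi>)"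

definition interp_at ::
    "('c, 'f, 'p, 'u, 'a::{boolean_algebra, complete_lattice}) struct \<Rightarrow> (nat \<Rightarrow> 'u) \<Rightarrow>
     ('c, 'f, 'p) fm \<Rightarrow> 'a \<times> 'a"
  where "interp_at \<AA> \<mu> \<phi> = interp \<AA> (close_fm \<mu> \<phi>)"


section \<open>Semantical consequence\<close>

definition conseq_in ::
    "('c, 'f, 'p, 'u, 'a::{boolean_algebra, complete_lattice}) struct \<Rightarrow>
     ('c, 'f, 'p) fm set \<Rightarrow> ('c, 'f, 'p) fm \<Rightarrow> bool"
  where "conseq_in \<AA> \<Gamma> \<phi> \<longleftrightarrow>
    ((\<forall>\<gamma>\<in>\<Gamma>. \<forall>\<mu>. range \<mu> \<subseteq> dom \<AA> \<longrightarrow> interp_at \<AA> \<mu> \<gamma> \<in> designated) \<longrightarrow>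
     (\<forall>\<mu>. range \<mu> \<subseteq> dom \<AA> \<longrightarrow> interp_at \<AA> \<mu> \<phi> \<in> designated))"

text \<open>HOL cannot quantify over types inside a formula, so the type \<open>'a\<close> of the complete Boolean
  algebra and the type \<open>'u\<close> containing the domain of the structure are parameters here. A theorem in
  which both are type variables speaks about all complete Boolean algebras and all structures.\<close>

definition conseq ::
    "'a::{boolean_algebra, complete_lattice} itself \<Rightarrow> 'u itself \<Rightarrow> ('c, 'f, 'p) sig \<Rightarrow>
     ('c, 'f, 'p) fm set \<Rightarrow> ('c, 'f, 'p) fm \<Rightarrow> bool"
  where "conseq TYPE('a) TYPE('u) \<Theta> \<Gamma> \<phi> \<longleftrightarrow>
    (\<forall>\<AA> :: ('c, 'f, 'p, 'u, 'a) struct. structure_over \<Theta> \<AA> \<longrightarrow> conseq_in \<AA> \<Gamma> \<phi>)"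

end

theory Submission
  imports Defs
begin

text \<open>Closing a formula under an assignment and interpreting the resulting sentence agrees with a
  Tarskian evaluation that carries the assignment along. For the latter the usual coincidence and
  substitution lemmas hold, and the values of well-formed formulas lie in the twist carrier because
  \<open>- \<Squnion>\<^sub>a z\<^sub>2(a) \<le> \<Sqinter>\<^sub>a z\<^sub>1(a)\<close>, which needs no complete distributivity. An implication is designated
  iff the first components of its sides are ordered, so the axioms become Boolean inequalities, and
  the rules preserve the property of being designated under all assignments.\<close>

section \<open>Evaluation under assignments\<close>

primrec eval_tm :: "('c, 'f, 'p, 'u, 'a) struct \<Rightarrow> (nat \<Rightarrow> 'u) \<Rightarrow> ('c, 'f) tm \<Rightarrow> 'u"
  where
    "eval_tm \<AA> \<mu> (Var x) = \<mu> x"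
  | "eval_tm \<AA> \<mu> (Const c) = cint \<AA> c"
  | "eval_tm \<AA> \<mu> (Fun f ts) = fint \<AA> f (map (eval_tm \<AA> \<mu>) ts)"

text \<open>\<open>interp\<close> descends into substituted instances; this recursion is structural,
  so formula induction applies to it directly.\<close>

primrec eval_fm ::
    "('c, 'f, 'p, 'u, 'a::{boolean_algebra, complete_lattice}) struct \<Rightarrow> (nat \<Rightarrow> 'u) \<Rightarrow>
     ('c, 'f, 'p) fm \<Rightarrow> 'a \<times> 'a"
  where
    "eval_fm \<AA> \<mu> (Pred p ts) = pint \<AA> p (map (eval_tm \<AA> \<mu>) ts)"
  | "eval_fm \<AA> \<mu> (\<alpha> \<^bold>\<and> \<beta>) = twist_and (eval_fm \<AA> \<mu> \<alpha>) (eval_fm \<AA> \<mu> \<beta>)"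
  | "eval_fm \<AA> \<mu> (\<alpha> \<^bold>\<or> \<beta>) = twist_or (eval_fm \<AA> \<mu> \<alpha>) (eval_fm \<AA> \<mu> \<beta>)"
  | "eval_fm \<AA> \<mu> (\<alpha> \<^bold>\<longrightarrow> \<beta>) = twist_imp (eval_fm \<AA> \<mu> \<alpha>) (eval_fm \<AA> \<mu> \<beta>)"
  | "eval_fm \<AA> \<mu> (\<^bold>\<not> \<alpha>) = twist_neg (eval_fm \<AA> \<mu> \<alpha>)"
  | "eval_fm \<AA> \<mu> (\<^bold>\<circ> \<alpha>) = twist_circ (eval_fm \<AA> \<mu> \<alpha>)"
  | "eval_fm \<AA> \<mu> (Forall x \<alpha>) =
      (INF a \<in> dom \<AA>. fst (eval_fm \<AA> (\<mu>(x := a)) \<alpha>),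
       SUP a \<in> dom \<AA>. snd (eval_fm \<AA> (\<mu>(x := a)) \<alpha>))"
  | "eval_fm \<AA> \<mu> (Exists x \<alpha>) =
      (SUP a \<in> dom \<AA>. fst (eval_fm \<AA> (\<mu>(x := a)) \<alpha>),
       INF a \<in> dom \<AA>. snd (eval_fm \<AA> (\<mu>(x := a)) \<alpha>))"

section \<open>Composition of substitutions\<close>

lemma subst_tm_cong:
  "(\<And>x. x \<in> vars_tm t \<Longrightarrow> \<sigma> x = \<tau> x) \<Longrightarrow> subst_tm \<sigma> t = subst_tm \<tau> t"
  by (induction t) auto

lemma subst_tm_subst_tm: "subst_tm \<tau> (subst_tm \<sigma> t) = subst_tm (\<lambda>y. subst_tm \<tau> (\<sigma> y)) t"
  by (induction t) auto

text \<open>The hypothesis on \<open>\<sigma>\<close> excludes capture.\<close>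

lemma subst_fm_subst_fm:
  fixes \<sigma> \<tau> :: "nat \<Rightarrow> ('c, 'f) tm" and \<phi> :: "('c, 'f, 'p) fm"
  assumes "\<And>y. \<sigma> y = Var y \<or> vars_tm (\<sigma> y) = {}"
  shows "subst_fm \<tau> (subst_fm \<sigma> \<phi>) = subst_fm (\<lambda>y. subst_tm \<tau> (\<sigma> y)) \<phi>"
proof -
  \<comment> \<open>Serves the quantifier cases, where both substitutions are reset at the bound
    variable. It is stated for all \<sigma> and \<tau> because the induction varies them.\<close>
  have upd: "(\<lambda>y. subst_tm (\<tau>(x := Var x)) ((\<sigma>(x := Var x)) y))
      = (\<lambda>y. subst_tm \<tau> (\<sigma> y))(x := Var x)"
    if "\<And>y. \<sigma> y = Var y \<or> vars_tm (\<sigma> y) = {}"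
    for \<sigma> \<tau> :: "nat \<Rightarrow> ('c, 'f) tm" and x
  proof
    fix y
    show "subst_tm (\<tau>(x := Var x)) ((\<sigma>(x := Var x)) y) = ((\<lambda>y. subst_tm \<tau> (\<sigma> y))(x := Var x)) y"
    proof (cases "y = x \<or> \<sigma> y = Var y")
      \<comment> \<open>Here \<open>\<sigma> y\<close> is closed, so resetting \<tau> at
        \<open>x\<close> cannot affect it.\<close>
      case False
      then have "vars_tm (\<sigma> y) = {}" using that by blast
      with False show ?thesis by (auto intro: subst_tm_cong)
    qed auto
  qed
  show ?thesis
    using assms
  proof (induction \<phi> arbitrary: \<sigma> \<tau>)
    case (Forall x \<phi>)
    have "(\<sigma>(x := Var x)) y = Var y \<or> vars_tm ((\<sigma>(x := Var x)) y) = {}" for y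
      using Forall.prems[of y] by simp
    then have "subst_fm (\<tau>(x := Var x)) (subst_fm (\<sigma>(x := Var x)) \<phi>)
        = subst_fm (\<lambda>y. subst_tm (\<tau>(x := Var x)) ((\<sigma>(x := Var x)) y)) \<phi>"
      by (rule Forall.IH)
    then show ?case
      by (simp only: upd[of \<sigma>, OF Forall.prems] subst_fm.simps)
  next
    case (Exists x \<phi>)
    have "(\<sigma>(x := Var x)) y = Var y \<or> vars_tm ((\<sigma>(x := Var x)) y) = {}" for y
      using Exists.prems[of y] by simp
    then have "subst_fm (\<tau>(x := Var x)) (subst_fm (\<sigma>(x := Var x)) \<phi>)
        = subst_fm (\<lambda>y. subst_tm (\<tau>(x := Var x)) ((\<sigma>(x := Var x)) y)) \<phi>"
      by (rule Exists.IH)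
    then show ?case
      by (simp only: upd[of \<sigma>, OF Exists.prems] subst_fm.simps)
  qed (auto simp: subst_tm_subst_tm)
qed

section \<open>Agreement of interpretation and evaluation\<close>

lemma tval_close_tm:
  "tval (hat \<AA>) (subst_tm (\<lambda>x. Const (Inr (\<mu> x))) (map_tm Inl (\<lambda>f. f) t)) = eval_tm \<AA> \<mu> t"
  by (induction t) (auto simp: hat_def comp_def cong: map_cong)

text \<open>Closing a quantified formula leaves \<open>x\<close> free in its body; naming
  \<open>a\<close> afterwards completes the closure under the updated assignment. Only constants and
  the variable itself are put in, so nothing is captured.\<close>

lemma close_fm_instance:
  "subst (subst_fm ((\<lambda>x. Const (Inr (\<mu> x)))(x := Var x)) (map_fm Inl (\<lambda>f. f) (\<lambda>p. p) \<phi>))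
      x (Const (Inr a)) = close_fm (\<mu>(x := a)) \<phi>"
    (is "subst (subst_fm ?\<sigma> _) _ _ = _")
proof -
  have "?\<sigma> y = Var y \<or> vars_tm (?\<sigma> y) = {}" for y
    by simp
  then have "subst_fm \<tau> (subst_fm ?\<sigma> \<psi>) = subst_fm (\<lambda>y. subst_tm \<tau> (?\<sigma> y)) \<psi>"
    for \<tau> and \<psi> :: "('a + 'b, 'c, 'd) fm"
    by (rule subst_fm_subst_fm)
  moreover have "(\<lambda>y. subst_tm (Var(x := Const (Inr a))) (?\<sigma> y)) = (\<lambda>y. Const (Inr ((\<mu>(x := a)) y)))"
    by auto
  ultimately show ?thesis
    unfolding subst_def close_fm_def by (simp only:)
qed

lemma interp_at_eq_eval_fm: "interp_at \<AA> \<mu> \<phi> = eval_fm \<AA> \<mu> \<phi>"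
proof (induction \<phi> arbitrary: \<mu>)
  case (Pred p ts)
  then show ?case
    by (simp add: interp_at_def close_fm_def comp_def tval_close_tm)
next
  case (Forall x \<phi>)
  \<comment> \<open>Read backwards, \<open>close_fm_instance\<close> identifies the instances
    visited by \<open>interp\<close> with closures under updated assignments, for which the
    induction hypothesis is available because \<mu> is arbitrary.\<close>
  have "interp_at \<AA> \<mu> (Forall x \<phi>) =
      (INF a \<in> dom \<AA>. fst (interp_at \<AA> (\<mu>(x := a)) \<phi>), SUP a \<in> dom \<AA>. snd (interp_at \<AA> (\<mu>(x := a)) \<phi>))"
    unfolding interp_at_def close_fm_instance[symmetric] by (simp add: close_fm_def)
  then show ?case by (simp only: Forall.IH eval_fm.simps)
next
  case (Exists x \<phi>)
  have "interp_at \<AA> \<mu> (Exists x \<phi>) =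
      (SUP a \<in> dom \<AA>. fst (interp_at \<AA> (\<mu>(x := a)) \<phi>), INF a \<in> dom \<AA>. snd (interp_at \<AA> (\<mu>(x := a)) \<phi>))"
    unfolding interp_at_def close_fm_instance[symmetric] by (simp add: close_fm_def)
  then show ?case by (simp only: Exists.IH eval_fm.simps)
qed (simp_all add: interp_at_def close_fm_def)

section \<open>Coincidence and substitution lemmas\<close>

lemma eval_tm_cong:
  "(\<And>x. x \<in> vars_tm t \<Longrightarrow> \<mu> x = \<nu> x) \<Longrightarrow> eval_tm \<AA> \<mu> t = eval_tm \<AA> \<nu> t"
proof (induction t)
  case (Fun f ts)
  then have "map (eval_tm \<AA> \<mu>) ts = map (eval_tm \<AA> \<nu>) ts" by auto
  then show ?case by (simp only: eval_tm.simps)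
qed auto

lemma eval_fm_cong:
  "(\<And>x. x \<in> free_vars \<phi> \<Longrightarrow> \<mu> x = \<nu> x) \<Longrightarrow> eval_fm \<AA> \<mu> \<phi> = eval_fm \<AA> \<nu> \<phi>"
proof (induction \<phi> arbitrary: \<mu> \<nu>)
  case (Pred p ts)
  then have "map (eval_tm \<AA> \<mu>) ts = map (eval_tm \<AA> \<nu>) ts"
    by (auto intro: eval_tm_cong)
  then show ?case by (simp only: eval_fm.simps)
next
  case (And \<alpha> \<beta>)
  have "eval_fm \<AA> \<mu> \<alpha> = eval_fm \<AA> \<nu> \<alpha>" "eval_fm \<AA> \<mu> \<beta> = eval_fm \<AA> \<nu> \<beta>"
    by (rule And.IH; simp add: And.prems)+
  then show ?case by simp
next
  case (Or \<alpha> \<beta>)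
  have "eval_fm \<AA> \<mu> \<alpha> = eval_fm \<AA> \<nu> \<alpha>" "eval_fm \<AA> \<mu> \<beta> = eval_fm \<AA> \<nu> \<beta>"
    by (rule Or.IH; simp add: Or.prems)+
  then show ?case by simp
next
  case (Imp \<alpha> \<beta>)
  have "eval_fm \<AA> \<mu> \<alpha> = eval_fm \<AA> \<nu> \<alpha>" "eval_fm \<AA> \<mu> \<beta> = eval_fm \<AA> \<nu> \<beta>"
    by (rule Imp.IH; simp add: Imp.prems)+
  then show ?case by simp
next
  case (Neg \<alpha>)
  have "eval_fm \<AA> \<mu> \<alpha> = eval_fm \<AA> \<nu> \<alpha>" by (rule Neg.IH) (simp add: Neg.prems)
  then show ?case by simp
next
  case (Circ \<alpha>)
  have "eval_fm \<AA> \<mu> \<alpha> = eval_fm \<AA> \<nu> \<alpha>" by (rule Circ.IH) (simp add: Circ.prems)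
  then show ?case by simp
next
  case (Forall x \<phi>)
  have "eval_fm \<AA> (\<mu>(x := a)) \<phi> = eval_fm \<AA> (\<nu>(x := a)) \<phi>" for a
    by (rule Forall.IH) (simp add: Forall.prems)
  then show ?case by simp
next
  case (Exists x \<phi>)
  have "eval_fm \<AA> (\<mu>(x := a)) \<phi> = eval_fm \<AA> (\<nu>(x := a)) \<phi>" for a
    by (rule Exists.IH) (simp add: Exists.prems)
  then show ?case by simp
qed

lemma eval_fm_upd_not_free: "x \<notin> free_vars \<phi> \<Longrightarrow> eval_fm \<AA> (\<mu>(x := a)) \<phi> = eval_fm \<AA> \<mu> \<phi>"
  by (rule eval_fm_cong) auto

lemma eval_tm_subst_tm: "eval_tm \<AA> \<mu> (subst_tm \<sigma> t) = eval_tm \<AA> (\<lambda>x. eval_tm \<AA> \<mu> (\<sigma> x)) t"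
  by (induction t) (auto simp: comp_def cong: map_cong)

lemma subst_tm_Var: "subst_tm Var t = t"
  by (induction t) (auto simp: map_idI)

lemma subst_fm_id: "(\<And>x. x \<in> free_vars \<phi> \<Longrightarrow> \<sigma> x = Var x) \<Longrightarrow> subst_fm \<sigma> \<phi> = \<phi>"
proof (induction \<phi> arbitrary: \<sigma>)
  case (Pred p ts)
  have "subst_tm \<sigma> t = t" if "t \<in> set ts" for t
  proof -
    have "subst_tm \<sigma> t = subst_tm Var t"
      using that by (intro subst_tm_cong Pred.prems) auto
    then show ?thesis by (simp add: subst_tm_Var)
  qed
  then show ?case by (simp add: map_idI)
qed auto

lemma subst_not_free: "x \<notin> free_vars \<phi> \<Longrightarrow> subst \<phi> x t = \<phi>"
  unfolding subst_def by (rule subst_fm_id) auto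

text \<open>At a quantifier over \<open>y\<close>, either \<open>x\<close> is not free and both
  sides ignore \<open>t\<close>, or \<open>y\<close> differs from \<open>x\<close> and does not
  occur in \<open>t\<close>. In the latter case rebinding \<open>y\<close> preserves the value of
  \<open>t\<close>, and the updates at \<open>x\<close> and \<open>y\<close> commute.\<close>

lemma eval_fm_subst:
  "free_for t x \<phi> \<Longrightarrow> eval_fm \<AA> \<mu> (subst \<phi> x t) = eval_fm \<AA> (\<mu>(x := eval_tm \<AA> \<mu> t)) \<phi>"
proof (induction \<phi> arbitrary: \<mu>)
  case (Pred p ts)
  have "(\<lambda>y. eval_tm \<AA> \<mu> ((Var(x := t)) y)) = \<mu>(x := eval_tm \<AA> \<mu> t)"
    by auto
  then show ?case
    by (simp only: subst_def subst_fm.simps eval_fm.simps map_map comp_def eval_tm_subst_tm)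
next
  case (Forall y \<phi>)
  show ?case
  proof (cases "x \<in> free_vars (Forall y \<phi>)")
    case True
    then have xy: "x \<noteq> y" and y: "y \<notin> vars_tm t" and ff: "free_for t x \<phi>"
      using Forall.prems by auto
    have t: "eval_tm \<AA> (\<mu>(y := a)) t = eval_tm \<AA> \<mu> t" for a
      using y by (auto intro: eval_tm_cong)
    \<comment> \<open>As \<open>x\<close> and \<open>y\<close> differ, the substitution already maps
      \<open>y\<close> to \<open>Var y\<close>, so resetting it there changes nothing.\<close>
    have "subst (Forall y \<phi>) x t = Forall y (subst \<phi> x t)"
      using xy by (simp add: subst_def fun_upd_idem)
    moreover have "eval_fm \<AA> (\<mu>(y := a)) (subst \<phi> x t)
        = eval_fm \<AA> (\<mu>(x := eval_tm \<AA> \<mu> t, y := a)) \<phi>" for a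
      using Forall.IH[OF ff, of "\<mu>(y := a)"] fun_upd_twist[OF xy, of \<mu>] by (simp only: t)
    ultimately show ?thesis by (simp only: eval_fm.simps)
  next
    case False
    then show ?thesis by (metis subst_not_free eval_fm_upd_not_free)
  qed
next
  case (Exists y \<phi>)
  show ?case
  proof (cases "x \<in> free_vars (Exists y \<phi>)")
    case True
    then have xy: "x \<noteq> y" and y: "y \<notin> vars_tm t" and ff: "free_for t x \<phi>"
      using Exists.prems by auto
    have t: "eval_tm \<AA> (\<mu>(y := a)) t = eval_tm \<AA> \<mu> t" for a
      using y by (auto intro: eval_tm_cong)
    have "subst (Exists y \<phi>) x t = Exists y (subst \<phi> x t)"
      using xy by (simp add: subst_def fun_upd_idem)
    moreover have "eval_fm \<AA> (\<mu>(y := a)) (subst \<phi> x t)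
        = eval_fm \<AA> (\<mu>(x := eval_tm \<AA> \<mu> t, y := a)) \<phi>" for a
      using Exists.IH[OF ff, of "\<mu>(y := a)"] fun_upd_twist[OF xy, of \<mu>] by (simp only: t)
    ultimately show ?thesis by (simp only: eval_fm.simps)
  next
    case False
    then show ?thesis by (metis subst_not_free eval_fm_upd_not_free)
  qed
qed (simp_all add: subst_def)


section \<open>Well-formedness\<close>

lemma wf_tm_of_subst_tm: "wf_tm \<Theta> (subst_tm \<sigma> t) \<Longrightarrow> x \<in> vars_tm t \<Longrightarrow> wf_tm \<Theta> (\<sigma> x)"
  by (induction t) (auto simp: list_all_iff)

lemma wf_tm_of_subst_fm: "wf_fm \<Theta> (subst_fm \<sigma> \<phi>) \<Longrightarrow> x \<in> free_vars \<phi> \<Longrightarrow> wf_tm \<Theta> (\<sigma> x)"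
proof (induction \<phi> arbitrary: \<sigma>)
  case (Pred p ts)
  then show ?case by (auto simp: list_all_iff intro: wf_tm_of_subst_tm)
next
  case (Forall y \<phi>)
  then have "wf_fm \<Theta> (subst_fm (\<sigma>(y := Var y)) \<phi>)" and x: "x \<in> free_vars \<phi>" "x \<noteq> y"
    by simp_all
  from Forall.IH[OF this(1,2)] x show ?case by simp
next
  case (Exists y \<phi>)
  then have "wf_fm \<Theta> (subst_fm (\<sigma>(y := Var y)) \<phi>)" and x: "x \<in> free_vars \<phi>" "x \<noteq> y"
    by simp_all
  from Exists.IH[OF this(1,2)] x show ?case by simp
qed auto

text \<open>Derivations only guarantee that the instance lies in \<open>For \<Theta>\<close>. When
  \<open>x\<close> is free, \<open>t\<close> occurs inside the instance and inherits well-formedness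
  from it.\<close>

lemma wf_tm_of_subst:
  assumes "wf_fm \<Theta> (subst \<phi> x t)" and "x \<in> free_vars \<phi>"
  shows "wf_tm \<Theta> t"
  using wf_tm_of_subst_fm[of \<Theta> "Var(x := t)" \<phi> x] assms by (simp add: subst_def)

lemma eval_tm_in_dom:
  assumes "structure_over \<Theta> \<AA>" and "range \<mu> \<subseteq> dom \<AA>"
  shows "wf_tm \<Theta> t \<Longrightarrow> eval_tm \<AA> \<mu> t \<in> dom \<AA>"
proof (induction t)
  case (Fun f ts)
  have "set (map (eval_tm \<AA> \<mu>) ts) \<subseteq> dom \<AA>"
    using Fun by (auto simp: list_all_iff)
  moreover have "length ts \<ge> 1" "f \<in> fun_syms \<Theta> (length ts)"
    using Fun.prems by auto
  ultimately show ?case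
    using assms(1) unfolding structure_over_def eval_tm.simps by (metis length_map)
qed (use assms in \<open>auto simp: structure_over_def\<close>)

text \<open>If \<open>x\<close> is not free in \<open>\<phi>\<close>, then \<open>t\<close> need not be a term over the signature and its value may lie
  outside the domain; any element of the domain serves instead.\<close>

lemma eval_fm_subst_instance:
  assumes "structure_over \<Theta> \<AA>" and "range \<mu> \<subseteq> dom \<AA>"
    and "wf_fm \<Theta> (subst \<phi> x t)" and "free_for t x \<phi>"
  obtains a where "a \<in> dom \<AA>" and "eval_fm \<AA> \<mu> (subst \<phi> x t) = eval_fm \<AA> (\<mu>(x := a)) \<phi>"
proof (cases "x \<in> free_vars \<phi>")
  case True
  then show ?thesis
    using that eval_tm_in_dom[OF assms(1,2)] wf_tm_of_subst[OF assms(3)] eval_fm_subst[OF assms(4)]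
    by blast
next
  case False
  then show ?thesis
    \<comment> \<open>With the witness \<open>\<mu> x\<close> the update is \<mu> itself.\<close>
    using that[of "\<mu> x"] assms(2) by (auto simp: subst_not_free)
qed


section \<open>Twist algebra\<close>

lemma in_twist_carrier_iff: "z \<in> twist_carrier \<longleftrightarrow> sup (fst z) (snd z) = top"
  by (cases z) (simp add: twist_carrier_def)

lemma in_designated_iff: "z \<in> designated \<longleftrightarrow> z \<in> twist_carrier \<and> fst z = top"
  by (cases z) (simp add: designated_def)

text \<open>The operations are defined by matching on pairs; these projections compute on values of
  formulas without splitting them.\<close>

lemma twist_simps [simp]:
  "fst (twist_and z w) = inf (fst z) (fst w)" "snd (twist_and z w) = sup (snd z) (snd w)"
  "fst (twist_or z w) = sup (fst z) (fst w)" "snd (twist_or z w) = inf (snd z) (snd w)"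
  "fst (twist_imp z w) = sup (- fst z) (fst w)" "snd (twist_imp z w) = inf (fst z) (snd w)"
  "fst (twist_neg z) = snd z" "snd (twist_neg z) = fst z"
  "fst (twist_circ z) = - inf (fst z) (snd z)" "snd (twist_circ z) = inf (fst z) (snd z)"
  by (cases z; cases w; simp)+

lemma sup_uminus_eq_top_iff: "sup (- x) y = top \<longleftrightarrow> x \<le> (y::'a::boolean_algebra)"
  by (metis boolean_algebra.de_Morgan_conj compl_le_swap1 inf.orderE inf_top_left shunt1 top_le top_greatest)

text \<open>By residuation the first premise bounds \<open>inf w x\<close> by \<open>y\<close>, and
  the second makes this meet equal to \<open>w\<close>.\<close>

lemma le_modus_ponens: "w \<le> sup (- x) y \<Longrightarrow> w \<le> x \<Longrightarrow> w \<le> (y::'a::boolean_algebra)"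
  by (metis inf.absorb1 shunt1)

lemma sup_eq_top_iff: "sup x y = top \<longleftrightarrow> - x \<le> (y::'a::boolean_algebra)"
  using sup_uminus_eq_top_iff[of "- x" y] by simp

text \<open>Each \<open>f i\<close> lies above \<open>- g i\<close>, hence above the complement of
  the supremum. This gives carrier membership for \<forall>, and for \<exists> with the two
  components exchanged.\<close>

lemma sup_Inf_Sup_eq_top:
  fixes f g :: "'b \<Rightarrow> 'a::{boolean_algebra, complete_lattice}"
  assumes "\<And>i. i \<in> I \<Longrightarrow> sup (f i) (g i) = top"
  shows "sup (INF i\<in>I. f i) (SUP i\<in>I. g i) = top"
proof -
  have "- (SUP i\<in>I. g i) \<le> (INF i\<in>I. f i)"
  proof (rule INF_greatest)
    fix i assume i: "i \<in> I"
    then have "- (SUP i\<in>I. g i) \<le> - g i" by (simp add: SUP_upper)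
    also have "\<dots> \<le> f i" using assms[OF i] by (simp add: sup_eq_top_iff[symmetric] sup.commute)
    finally show "- (SUP i\<in>I. g i) \<le> f i" .
  qed
  then show ?thesis by (metis sup.commute sup_eq_top_iff)
qed

lemma twist_closed:
  assumes "z \<in> twist_carrier" and "w \<in> twist_carrier"
  shows "twist_and z w \<in> twist_carrier" "twist_or z w \<in> twist_carrier"
    "twist_imp z w \<in> twist_carrier" "twist_neg z \<in> twist_carrier" "twist_circ z \<in> twist_carrier"
proof -
  obtain a b c d where zw: "z = (a, b)" "w = (c, d)" by fastforce
  have ab: "sup a b = top" and cd: "sup c d = top"
    using assms by (auto simp: zw twist_carrier_def)
  \<comment> \<open>Distributing \<open>sup\<close> over \<open>inf\<close> in the carrier condition
    leaves exactly these joins; each contains both components of \<open>z\<close> or of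
    \<open>w\<close>.\<close>
  have "sup a (sup b d) = top" "sup c (sup b d) = top" "sup (sup a c) b = top" "sup (sup a c) d = top"
    using ab cd by (metis sup.assoc sup.commute sup_top_left)+
  then show "twist_and z w \<in> twist_carrier" "twist_or z w \<in> twist_carrier"
    by (simp_all add: zw twist_carrier_def sup_inf_distrib1 sup_inf_distrib2)
  have "sup (sup (- a) c) a = top" "sup (sup (- a) c) d = top"
    using cd by (metis sup.assoc sup.commute sup_top_left sup_compl_top)+
  then show "twist_imp z w \<in> twist_carrier"
    by (simp add: zw twist_carrier_def sup_inf_distrib1)
  show "twist_neg z \<in> twist_carrier" using ab by (simp add: zw twist_carrier_def sup.commute)
  show "twist_circ z \<in> twist_carrier" by (simp add: zw twist_carrier_def sup_inf_distrib1 sup_eq_top_iff)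
qed

text \<open>Used for \<open>A10\<close>, which expresses the carrier condition itself, and for
  designation, which demands carrier membership besides a first component equal to
  \<open>top\<close>.\<close>

lemma eval_fm_in_twist_carrier:
  assumes "structure_over \<Theta> \<AA>"
  shows "wf_fm \<Theta> \<phi> \<Longrightarrow> range \<mu> \<subseteq> dom \<AA> \<Longrightarrow> eval_fm \<AA> \<mu> \<phi> \<in> twist_carrier"
proof (induction \<phi> arbitrary: \<mu>)
  case (Pred p ts)
  have "set (map (eval_tm \<AA> \<mu>) ts) \<subseteq> dom \<AA>"
    using Pred eval_tm_in_dom[OF assms] by (auto simp: list_all_iff)
  moreover have "length ts \<ge> 1" "p \<in> pred_syms \<Theta> (length ts)"
    using Pred.prems by auto
  ultimately show ?case
    using assms unfolding structure_over_def eval_fm.simps by (metis length_map)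
next
  case (Forall x \<phi>)
  have "eval_fm \<AA> (\<mu>(x := a)) \<phi> \<in> twist_carrier" if "a \<in> dom \<AA>" for a
    using Forall.prems that by (intro Forall.IH) auto
  then show ?case
    by (simp add: in_twist_carrier_iff sup_Inf_Sup_eq_top)
next
  case (Exists x \<phi>)
  have "eval_fm \<AA> (\<mu>(x := a)) \<phi> \<in> twist_carrier" if "a \<in> dom \<AA>" for a
    using Exists.prems that by (intro Exists.IH) auto
  then show ?case
    by (simp add: in_twist_carrier_iff sup_Inf_Sup_eq_top sup.commute)
qed (auto intro: twist_closed)


section \<open>Soundness\<close>

lemma fst_eval_Imp_eq_top_iff:
  "fst (eval_fm \<AA> \<mu> (\<alpha> \<^bold>\<longrightarrow> \<beta>)) = top \<longleftrightarrow> fst (eval_fm \<AA> \<mu> \<alpha>) \<le> fst (eval_fm \<AA> \<mu> \<beta>)"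
  by (simp add: sup_uminus_eq_top_iff)

lemma fst_eval_Iff_eq_top_iff:
  "fst (eval_fm \<AA> \<mu> (\<alpha> \<^bold>\<longleftrightarrow> \<beta>)) = top \<longleftrightarrow> fst (eval_fm \<AA> \<mu> \<alpha>) = fst (eval_fm \<AA> \<mu> \<beta>)"
  by (simp add: sup_uminus_eq_top_iff inf_eq_top_iff order_eq_iff[of "fst (eval_fm \<AA> \<mu> \<alpha>)"])

lemma ax_fst_eval_eq_top:
  fixes \<AA> :: "('c, 'f, 'p, 'u, 'a::{boolean_algebra, complete_lattice}) struct"
  assumes "structure_over \<Theta> \<AA>" and "range \<mu> \<subseteq> dom \<AA>" and "ax \<phi>" and "wf_fm \<Theta> \<phi>"
  shows "fst (eval_fm \<AA> \<mu> \<phi>) = top"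
  using assms(3)
proof cases
  case (A2 \<alpha> \<beta> \<gamma>)
  have "sup (- a) (sup (- b) c) \<le> sup (- sup (- a) b) (sup (- a) c)" for a b c :: 'a
  proof -
    \<comment> \<open>The meet of all three antecedents; residuation reduces the nested implication
      to \<open>?w \<le> c\<close>, reached by repeated modus ponens below
      \<open>?w\<close>.\<close>
    let ?w = "inf (inf (sup (- a) (sup (- b) c)) (sup (- a) b)) a"
    have a: "?w \<le> a" by simp
    have "?w \<le> b" by (rule le_modus_ponens[OF _ a]) (simp add: le_infI1)
    moreover have "?w \<le> sup (- b) c" by (rule le_modus_ponens[OF _ a]) (simp add: le_infI1)
    ultimately have "?w \<le> c" by (rule le_modus_ponens[rotated])
    then show ?thesis by (simp only: shunt1)
  qed
  then show ?thesis unfolding A2 fst_eval_Imp_eq_top_iff by simp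
next
  case (A8 \<alpha> \<gamma> \<beta>)
  have "sup (- a) c \<le> sup (- sup (- b) c) (sup (- sup a b) c)" for a b c :: 'a
  proof -
    \<comment> \<open>Below both implications, \<open>c\<close> bounds the meets with
      \<open>a\<close> and with \<open>b\<close> separately; distributivity combines them into the
      bound for \<open>sup a b\<close>.\<close>
    let ?w = "inf (sup (- a) c) (sup (- b) c)"
    have "inf ?w a \<le> c" "inf ?w b \<le> c"
      by (rule le_modus_ponens[of _ a] le_modus_ponens[of _ b]; simp add: le_infI1)+
    then have "inf ?w (sup a b) \<le> c" by (simp only: inf_sup_distrib1 le_sup_iff)
    then show ?thesis by (simp only: shunt1)
  qed
  then show ?thesis unfolding A8 fst_eval_Imp_eq_top_iff by simp
next
  case (A10 \<alpha>)
  then show ?thesis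
    using eval_fm_in_twist_carrier[OF assms(1), of \<alpha> \<mu>] assms(2,4) by (simp add: in_twist_carrier_iff)
next
  case (A11 \<alpha> \<beta>)
  \<comment> \<open>Here \<open>a\<close> and \<open>b\<close> stand for the two components of the
    value of \<alpha>, and \<open>c\<close> for the first component of that of \<beta>.\<close>
  have "- inf a b \<le> sup (- a) (sup (- b) c)" for a b c :: 'a
    by (simp add: sup.assoc[symmetric])
  then show ?thesis unfolding A11 fst_eval_Imp_eq_top_iff by simp
next
  case (Ax12 t x \<psi>)
  then have "wf_fm \<Theta> (subst \<psi> x t)" using assms(4) by simp
  \<comment> \<open>The instance takes one of the values over which the quantifier forms its
    supremum; \<open>Ax13\<close> is dual.\<close>
  then obtain a where "a \<in> dom \<AA>" "eval_fm \<AA> \<mu> (subst \<psi> x t) = eval_fm \<AA> (\<mu>(x := a)) \<psi>"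
    using eval_fm_subst_instance[OF assms(1,2)] Ax12 by metis
  then show ?thesis
    unfolding Ax12 fst_eval_Imp_eq_top_iff by (auto intro: SUP_upper)
next
  case (Ax13 t x \<psi>)
  then have "wf_fm \<Theta> (subst \<psi> x t)" using assms(4) by simp
  then obtain a where "a \<in> dom \<AA>" "eval_fm \<AA> \<mu> (subst \<psi> x t) = eval_fm \<AA> (\<mu>(x := a)) \<psi>"
    using eval_fm_subst_instance[OF assms(1,2)] Ax13 by metis
  then show ?thesis
    unfolding Ax13 fst_eval_Imp_eq_top_iff by (auto intro: INF_lower)
\<comment> \<open>Since \<open>twist_neg\<close> swaps components, \<open>ci\<close> and the
  biconditional axioms compare equal first components. The others are elementary lattice facts; in
  \<open>A9\<close> the join contains an element and its complement.\<close>
qed (simp_all only: fst_eval_Imp_eq_top_iff fst_eval_Iff_eq_top_iff,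
  simp_all add: shunt1[symmetric] sup_eq_top_iff le_supI1 le_supI2 inf.commute)

text \<open>The premises must be known under every assignment: the quantifier rules read theirs at
  \<open>\<mu>(x := a)\<close> for each \<open>a\<close> in the domain. The side condition keeps the
  value of the other formula fixed, so it bounds the whole family.\<close>

lemma rule_from_fst_eval_eq_top:
  assumes "rule_from X \<phi>"
    and X: "\<And>\<psi> \<mu>. \<psi> \<in> X \<Longrightarrow> range \<mu> \<subseteq> dom \<AA> \<Longrightarrow> fst (eval_fm \<AA> \<mu> \<psi>) = top"
    and \<mu>: "range \<mu> \<subseteq> dom \<AA>"
  shows "fst (eval_fm \<AA> \<mu> \<phi>) = top"
  using assms(1)
proof cases
  case (MP \<alpha>)
  then show ?thesis using X[OF MP(1) \<mu>] X[OF MP(2) \<mu>] by simp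
next
  case (Exists_In \<chi> \<psi> x)
  have "fst (eval_fm \<AA> (\<mu>(x := a)) \<chi>) \<le> fst (eval_fm \<AA> \<mu> \<psi>)" if "a \<in> dom \<AA>" for a
  proof -
    have "range (\<mu>(x := a)) \<subseteq> dom \<AA>" using \<mu> that by auto
    from X[OF Exists_In(2) this] show ?thesis
      by (simp only: fst_eval_Imp_eq_top_iff eval_fm_upd_not_free[OF Exists_In(3)])
  qed
  then show ?thesis
    unfolding Exists_In(1) fst_eval_Imp_eq_top_iff by (auto intro: SUP_least)
next
  case (Forall_In \<chi> \<psi> x)
  have "fst (eval_fm \<AA> \<mu> \<chi>) \<le> fst (eval_fm \<AA> (\<mu>(x := a)) \<psi>)" if "a \<in> dom \<AA>" for a
  proof -
    have "range (\<mu>(x := a)) \<subseteq> dom \<AA>" using \<mu> that by auto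
    from X[OF Forall_In(2) this] show ?thesis
      by (simp only: fst_eval_Imp_eq_top_iff eval_fm_upd_not_free[OF Forall_In(3)])
  qed
  then show ?thesis
    unfolding Forall_In(1) fst_eval_Imp_eq_top_iff by (auto intro: INF_greatest)
qed

lemma derivation_fst_eval_eq_top:
  assumes "structure_over \<Theta> \<AA>" and "derivation \<Theta> \<Gamma> \<phi>s"
    and "\<And>\<gamma> \<mu>. \<gamma> \<in> \<Gamma> \<Longrightarrow> range \<mu> \<subseteq> dom \<AA> \<Longrightarrow> fst (eval_fm \<AA> \<mu> \<gamma>) = top"
  shows "i < length \<phi>s \<Longrightarrow> range \<mu> \<subseteq> dom \<AA> \<Longrightarrow> fst (eval_fm \<AA> \<mu> (\<phi>s ! i)) = top"
\<comment> \<open>The assignment is generalised because a quantifier rule uses earlier steps at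
  other assignments.\<close>
proof (induction i arbitrary: \<mu> rule: less_induct)
  case (less i)
  have earlier: "fst (eval_fm \<AA> \<nu> \<psi>) = top"
    if "\<psi> \<in> set (take i \<phi>s)" and "range \<nu> \<subseteq> dom \<AA>" for \<psi> \<nu>
    using that less.IH less.prems(1) by (auto simp: in_set_conv_nth)
  have "wf_fm \<Theta> (\<phi>s ! i)"
    and "ax (\<phi>s ! i) \<or> \<phi>s ! i \<in> \<Gamma> \<or> rule_from (set (take i \<phi>s)) (\<phi>s ! i)"
    using assms(2) less.prems(1) by (auto simp: derivation_def For_def)
  then show ?case
    using ax_fst_eval_eq_top[OF assms(1)] assms(3) rule_from_fst_eval_eq_top[OF _ earlier]
      less.prems(2) by blast
qed

theorem theorem12p20:
  fixes \<Theta> :: "('c, 'f, 'p) sig"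
    and \<Gamma> :: "('c, 'f, 'p) fm set"
    and \<phi> :: "('c, 'f, 'p) fm"
  assumes "signature \<Theta>"
    and "\<Gamma> \<union> {\<phi>} \<subseteq> For \<Theta>"
    and "derivable \<Theta> \<Gamma> \<phi>"
  shows "conseq TYPE('a::{boolean_algebra, complete_lattice}) TYPE('u) \<Theta> \<Gamma> \<phi>"
  unfolding conseq_def conseq_in_def interp_at_eq_eval_fm
proof (intro allI impI)
  fix \<AA> :: "('c, 'f, 'p, 'u, 'a) struct" and \<mu> :: "nat \<Rightarrow> 'u"
  assume \<AA>: "structure_over \<Theta> \<AA>" and \<mu>: "range \<mu> \<subseteq> dom \<AA>"
    and \<Gamma>: "\<forall>\<gamma>\<in>\<Gamma>. \<forall>\<mu>. range \<mu> \<subseteq> dom \<AA> \<longrightarrow> eval_fm \<AA> \<mu> \<gamma> \<in> designated"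
  obtain \<phi>s where \<phi>s: "derivation \<Theta> \<Gamma> \<phi>s" "\<phi>s \<noteq> []" "last \<phi>s = \<phi>"
    using assms(3) by (auto simp: derivable_def)
  \<comment> \<open>The conclusion is the last step, at index \<open>length \<phi>s - 1\<close>;
    this index is valid since the derivation is nonempty.\<close>
  have "fst (eval_fm \<AA> \<mu> (\<phi>s ! (length \<phi>s - 1))) = top"
    using \<Gamma> \<phi>s(2) \<mu> by (intro derivation_fst_eval_eq_top[OF \<AA> \<phi>s(1)]) (auto simp: in_designated_iff)
  \<comment> \<open>Carrier membership comes from \<phi> lying in
    \<open>For \<Theta>\<close>.\<close>
  then show "eval_fm \<AA> \<mu> \<phi> \<in> designated"
    using \<phi>s(2,3) eval_fm_in_twist_carrier[OF \<AA> _ \<mu>] assms(2)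
    by (auto simp: in_designated_iff For_def last_conv_nth)
qed

end
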